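(* Let $(A,\rhd,\lhd,\delta_{\rhd},\delta_{\lhd})$ be a bi-dialgebra. Then $(A,[\cdot,\cdot],\delta_{[\cdot,\cdot]})$ is a Leibniz bialgebra, where $$[x,y]=x\rhd y-y\lhd x\quad (x,y\in A),\qquad \delta_{[\cdot,\cdot]}=\delta_{\rhd}-\tau\delta_{\lhd}.$$
   Context: All vector spaces and algebras are finite-dimensional over a field $\mathbb F$ of characteristic $0$; algebras are not assumed unital. Notation: $L_\diamond(x)y=x\diamond y=R_\diamond(y)x$ for a product $\diamond$ (including brackets), $\tau(x\otimes y)=y\otimes x$. **Dialgebra.** $(A,\rhd,\lhd)$ where $\rhd,\lhd$ are associative bilinear products with $(x\lhd y)\lhd z=x\lhd(y\rhd z)$, $(x\rhd y)\lhd z=x\rhd(y\lhd z)$, $(x\lhd y)\rhd z=x\rhd(y\rhd z)$. **Co-dialgebra.** $(A,\delta_{\rhd},\delta_{\lhd})$ with $\delta_{\rhd},\delta_{\lhd}:A\to A\otimes A$ linear and coassociative, $(\mathrm{id}\otimes\delta)\delta=(\delta\otimes\mathrm{id})\delta$, and $(\mathrm{id}\otimes\delta_{\lhd})\delta_{\lhd}=(\mathrm{id}\otimes\delta_{\rhd})\delta_{\lhd}$, $(\delta_{\rhd}\otimes\mathrm{id})\delta_{\lhd}=(\mathrm{id}\otimes\delta_{\lhd})\delta_{\rhd}$, $(\delta_{\lhd}\otimes\mathrm{id})\delta_{\rhd}=(\delta_{\rhd}\otimes\mathrm{id})\delta_{\rhd}$. **Bi-dialgebra.** $(A,\rhd,\lhd,\delta_{\rhd},\delta_{\lhd})$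 with $(A,\rhd,\lhd)$ a dialgebra, $(A,\delta_{\rhd},\delta_{\lhd})$ a co-dialgebra, and, with $x\star y=x\rhd y-x\lhd y$ and $\delta_\star=\delta_{\rhd}-\delta_{\lhd}$, for all $x,y\in A$: $(\mathrm{id}\otimes L_{\lhd}(x))\delta_{\lhd}(y)=(R_{\rhd}(y)\otimes\mathrm{id})\delta_{\rhd}(x)$; $(L_{\lhd}(x)\otimes\mathrm{id})\delta_{\rhd}(y)=(\mathrm{id}\otimes L_{\lhd}(y))\tau\delta_{\rhd}(x)$; $(R_{\rhd}(x)\otimes\mathrm{id})\tau\delta_{\lhd}(y)=(\mathrm{id}\otimes R_{\rhd}(y))\delta_{\lhd}(x)$; $\delta_{\rhd}(x\rhd y)=(\mathrm{id}\otimes L_{\rhd}(x))\delta_{\rhd}(y)-(R_{\star}(y)\otimes\mathrm{id})\delta_{\star}(x)$; $\delta_{\rhd}(x\lhd y)=(\mathrm{id}\otimes L_{\lhd}(x))\delta_{\star}(y)+(R_{\lhd}(y)\otimes\mathrm{id})\delta_{\rhd}(x)$; $\delta_{\lhd}(x\rhd y)=(\mathrm{id}\otimes L_{\star}(x))\delta_{\lhd}(y)+(R_{\rhd}(y)\otimes\mathrm{id})\delta_{\lhd}(x)$; $\delta_{\lhd}(x\lhd y)=(R_{\lhd}(y)\otimes\mathrm{id})\delta_{\lhd}(x)-(\mathrm{id}\otimes L_{\star}(x))\delta_{\star}(y)$; $(L_{\star}(x)\otimes\mathrm{id})\delta_{\rhd}(y)+(\mathrm{id}\otimes L_{\lhd}(y))\tau\delta_{\lhd}(x)=(R_{\star}(y)\otimes\mathrm{id})\tau\delta_{\star}(x)+(\mathrm{id}\otimes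 R_{\lhd}(x))\delta_{\rhd}(y)$; $(R_{\lhd}(x)\otimes\mathrm{id})\tau\delta_{\lhd}(y)+(\mathrm{id}\otimes R_{\rhd}(y))\delta_{\star}(x)=(L_{\star}(y)\otimes\mathrm{id})\delta_{\star}(x)+(\mathrm{id}\otimes L_{\rhd}(x))\tau\delta_{\lhd}(y)$. **Leibniz bialgebra.** A Leibniz algebra satisfies $[x,[y,z]]=[[x,y],z]+[y,[x,z]]$. A Leibniz coalgebra $(A,\delta_{[\cdot,\cdot]})$, with $\delta_{[\cdot,\cdot]}:A\to A\otimes A$ linear, satisfies $(\mathrm{id}\otimes\delta_{[\cdot,\cdot]})\delta_{[\cdot,\cdot]}=(\delta_{[\cdot,\cdot]}\otimes\mathrm{id})\delta_{[\cdot,\cdot]}+(\tau\otimes\mathrm{id})(\mathrm{id}\otimes\delta_{[\cdot,\cdot]})\delta_{[\cdot,\cdot]}$. A Leibniz bialgebra $(A,[\cdot,\cdot],\delta_{[\cdot,\cdot]})$ consists of a Leibniz algebra $(A,[\cdot,\cdot])$ and a Leibniz coalgebra $(A,\delta_{[\cdot,\cdot]})$ such that for all $x,y\in A$ $(\mathrm{id}\otimes R_{[\cdot,\cdot]}(x))\tau\delta_{[\cdot,\cdot]}(y)=(R_{[\cdot,\cdot]}(y)\otimes\mathrm{id})\delta_{[\cdot,\cdot]}(x)$, $\delta_{[\cdot,\cdot]}([x,y])=(\mathrm{id}\otimes R_{[\cdot,\cdot]}(y)-L_{\square}(y)\otimes\mathrm{id})\delta_{\square}(x)+(\mathrm{id}\otimes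 L_{[\cdot,\cdot]}(x)+L_{[\cdot,\cdot]}(x)\otimes\mathrm{id})\delta_{[\cdot,\cdot]}(y)$, where $x\,\square\,y=[x,y]+[y,x]$ and $\delta_{\square}=\delta_{[\cdot,\cdot]}+\tau\delta_{[\cdot,\cdot]}$. *)

theory Defs
  imports Complex_Main "HOL-Library.Function_Algebras"
begin

text \<open>
  A vector space is given by its scalar multiplication on a whole type, as in
  \<^theory>\<open>HOL.Vector_Spaces\<close>. There is no tensor product in the library, and a type of
  tensors cannot depend on the scalar multiplication, so elements of \<open>A \<otimes> A\<close> and
  \<open>A \<otimes> A \<otimes> A\<close> are represented as functions: \<open>x \<otimes> y\<close> is the bilinear form
  \<open>(\<phi>, \<psi>) \<mapsto> \<phi> x * \<psi> y\<close> on the dual space, and \<open>A \<otimes> A\<close> is the span of these. Functions take the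
  value 0 at arguments that are not linear functionals, so equality of tensors is equality in HOL.
  Sums and differences of tensors are the pointwise ones of
  \<^theory>\<open>HOL-Library.Function_Algebras\<close>. The triple tensor product is treated in the same way,
  with the usual identification of its two bracketings. The lemmas \<open>tensor_universal\<close> and
  \<open>tensor3_universal\<close> below show that these spaces have the universal property of tensor products.
\<close>

type_synonym ('a, 'f) tensor2 = "('a \<Rightarrow> 'f) \<Rightarrow> ('a \<Rightarrow> 'f) \<Rightarrow> 'f"
type_synonym ('a, 'f) tensor3 = "('a \<Rightarrow> 'f) \<Rightarrow> ('a \<Rightarrow> 'f) \<Rightarrow> ('a \<Rightarrow> 'f) \<Rightarrow> 'f"

definition scale2 :: "'f::field \<Rightarrow> ('a, 'f) tensor2 \<Rightarrow> ('a, 'f) tensor2" where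
  "scale2 c t = (\<lambda>\<phi> \<psi>. c * t \<phi> \<psi>)"

definition scale3 :: "'f::field \<Rightarrow> ('a, 'f) tensor3 \<Rightarrow> ('a, 'f) tensor3" where
  "scale3 c t = (\<lambda>\<phi> \<psi> \<chi>. c * t \<phi> \<psi> \<chi>)"

definition swap :: "('a, 'f) tensor2 \<Rightarrow> ('a, 'f) tensor2" ("\<tau>") where
  "\<tau> t = (\<lambda>\<phi> \<psi>. t \<psi> \<phi>)"

definition swap_id :: "('a, 'f) tensor3 \<Rightarrow> ('a, 'f) tensor3" ("\<tau>\<otimes>id") where
  "\<tau>\<otimes>id t = (\<lambda>\<phi> \<psi> \<chi>. t \<psi> \<phi> \<chi>)"

definition left_mult :: "('a \<Rightarrow> 'a \<Rightarrow> 'a) \<Rightarrow> 'a \<Rightarrow> 'a \<Rightarrow> 'a" ("L") where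
  "L p x = (\<lambda>y. p x y)"

definition right_mult :: "('a \<Rightarrow> 'a \<Rightarrow> 'a) \<Rightarrow> 'a \<Rightarrow> 'a \<Rightarrow> 'a" ("R") where
  "R p y = (\<lambda>x. p x y)"

lemma vector_space_scale2: "vector_space scale2"
  by unfold_locales (auto simp: plus_fun_def scale2_def fun_eq_iff algebra_simps)

lemma vector_space_scale3: "vector_space scale3"
  by unfold_locales (auto simp: plus_fun_def scale3_def fun_eq_iff algebra_simps)

lemma linearI:
  assumes "vector_space s" "vector_space s'"
    "\<And>x y. f (x + y) = f x + f y" "\<And>c x. f (s c x) = s' c (f x)"
  shows "Vector_Spaces.linear s s' f"
  using assms by (simp add: Vector_Spaces.linear_iff)

lemma linear_0': "Vector_Spaces.linear s s' f \<Longrightarrow> f 0 = 0"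
  unfolding Vector_Spaces.linear_iff by (metis add_cancel_left_right add_0)

lemma vector_space_field: "vector_space ((*) :: 'f::field \<Rightarrow> _)"
  by unfold_locales (auto simp: algebra_simps)


locale fin_dim_space = vector_space scale
  for scale :: "'f::field_char_0 \<Rightarrow> 'a::ab_group_add \<Rightarrow> 'a" (infixr "*s" 75) +
  assumes finite_dim: "\<exists>B. finite B \<and> span B = UNIV"
begin

definition bilinear_product :: "('a \<Rightarrow> 'a \<Rightarrow> 'a) \<Rightarrow> bool" where
  "bilinear_product p \<longleftrightarrow>
    (\<forall>x. Vector_Spaces.linear scale scale (\<lambda>y. p x y)) \<and>
    (\<forall>y. Vector_Spaces.linear scale scale (\<lambda>x. p x y))"

definition functional :: "('a \<Rightarrow> 'f) \<Rightarrow> bool" where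
  "functional \<phi> \<longleftrightarrow> Vector_Spaces.linear scale (*) \<phi>"

definition tensor :: "'a \<Rightarrow> 'a \<Rightarrow> ('a, 'f) tensor2" (infix "\<otimes>" 73) where
  "x \<otimes> y = (\<lambda>\<phi> \<psi>. if functional \<phi> \<and> functional \<psi> then \<phi> x * \<psi> y else 0)"

definition tensor3 :: "'a \<Rightarrow> 'a \<Rightarrow> 'a \<Rightarrow> ('a, 'f) tensor3" where
  "tensor3 x y z = (\<lambda>\<phi> \<psi> \<chi>.
    if functional \<phi> \<and> functional \<psi> \<and> functional \<chi> then \<phi> x * \<psi> y * \<chi> z else 0)"

definition tensor_space :: "('a, 'f) tensor2 set" where
  "tensor_space = module.span scale2 {x \<otimes> y | x y. True}"

definition tensor3_space :: "('a, 'f) tensor3 set" where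
  "tensor3_space = module.span scale3 {tensor3 x y z | x y z. True}"

text \<open>\<open>f \<otimes> g\<close> for linear maps \<open>f\<close> and \<open>g\<close>, by pulling functionals back along \<open>f\<close> and \<open>g\<close>;
  see \<open>tensor_map_tensor\<close>.\<close>

definition tensor_map :: "('a \<Rightarrow> 'a) \<Rightarrow> ('a \<Rightarrow> 'a) \<Rightarrow> ('a, 'f) tensor2 \<Rightarrow> ('a, 'f) tensor2"
    (infix "\<otimes>\<^sub>m" 73) where
  "(f \<otimes>\<^sub>m g) t =
    (\<lambda>\<phi> \<psi>. if functional \<phi> \<and> functional \<psi> then t (\<phi> \<circ> f) (\<psi> \<circ> g) else 0)"

definition comultiplication :: "('a \<Rightarrow> ('a, 'f) tensor2) \<Rightarrow> bool" where
  "comultiplication \<delta> \<longleftrightarrow>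
    Vector_Spaces.linear scale scale2 \<delta> \<and> (\<forall>x. \<delta> x \<in> tensor_space)"

text \<open>The maps \<open>id \<otimes> \<delta>\<close> and \<open>\<delta> \<otimes> id\<close> for \<open>\<delta> : A \<rightarrow> A \<otimes> A\<close>; see \<open>id_tensor_tensor\<close> and
  \<open>tensor_id_tensor\<close>.\<close>

definition id_tensor :: "('a \<Rightarrow> ('a, 'f) tensor2) \<Rightarrow> ('a, 'f) tensor2 \<Rightarrow> ('a, 'f) tensor3"
    ("id\<otimes>_" [1000] 1000) where
  "(id\<otimes>\<delta>) t = (\<lambda>\<phi> \<psi> \<chi>.
    if functional \<phi> \<and> functional \<psi> \<and> functional \<chi> then t \<phi> (\<lambda>y. \<delta> y \<psi> \<chi>) else 0)"

definition tensor_id :: "('a \<Rightarrow> ('a, 'f) tensor2) \<Rightarrow> ('a, 'f) tensor2 \<Rightarrow> ('a, 'f) tensor3"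
    ("_\<otimes>id" [1000] 1000) where
  "(\<delta>\<otimes>id) t = (\<lambda>\<phi> \<psi> \<chi>.
    if functional \<phi> \<and> functional \<psi> \<and> functional \<chi> then t (\<lambda>x. \<delta> x \<phi> \<psi>) \<chi> else 0)"


lemma functionalD:
  assumes "functional \<phi>"
  shows "\<phi> (x + y) = \<phi> x + \<phi> y" "\<phi> (c *s x) = c * \<phi> x"
  using assms by (auto simp: functional_def Vector_Spaces.linear_iff)

lemma functionalI:
  assumes "\<And>x y. \<phi> (x + y) = \<phi> x + \<phi> y" "\<And>c x. \<phi> (c *s x) = c * \<phi> x"
  shows "functional \<phi>"
  unfolding functional_def
  by (rule linearI[OF vector_space_axioms vector_space_field]) (use assms in auto)

lemma functional_comp:
  assumes "functional \<phi>" "Vector_Spaces.linear scale scale f"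
  shows "functional (\<phi> \<circ> f)"
  using assms by (auto simp: functional_def Vector_Spaces.linear_iff)

lemma tensor_space_induct [consumes 1, case_names zero pure add scale]:
  assumes "t \<in> tensor_space" "P 0" "\<And>x y. P (x \<otimes> y)"
    "\<And>s t. P s \<Longrightarrow> P t \<Longrightarrow> P (s + t)" "\<And>c t. P t \<Longrightarrow> P (scale2 c t)"
  shows "P t"
proof -
  interpret T: vector_space scale2 by (rule vector_space_scale2)
  show ?thesis
    using assms(1) unfolding tensor_space_def
    by (induction rule: T.span_induct)
      (use assms in \<open>auto simp del: plus_fun_apply simp: T.subspace_def\<close>)
qed

lemma tensor3_space_induct [consumes 1, case_names zero pure add scale]:
  assumes "t \<in> tensor3_space" "P 0" "\<And>x y z. P (tensor3 x y z)"
    "\<And>s t. P s \<Longrightarrow> P t \<Longrightarrow> P (s + t)" "\<And>c t. P t \<Longrightarrow> P (scale3 c t)"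
  shows "P t"
proof -
  interpret T: vector_space scale3 by (rule vector_space_scale3)
  show ?thesis
    using assms(1) unfolding tensor3_space_def
    by (induction rule: T.span_induct)
      (use assms in \<open>auto simp del: plus_fun_apply simp: T.subspace_def\<close>)
qed

lemma dual_basis:
  obtains B :: "'a set" and \<rho> where "finite B" "\<And>b. functional (\<lambda>x. \<rho> x b)"
    "\<And>x. (\<Sum>b\<in>B. \<rho> x b *s b) = x"
proof -
  obtain C where C: "finite C" "span C = UNIV" using finite_dim by blast
  obtain B where B: "B \<subseteq> C" "independent B" "C \<subseteq> span B"
    by (metis maximal_independent_subset)
  have fB: "finite B" using B C finite_subset by blast
  have sB: "span B = UNIV" using B(3) C(2) by (metis span_mono span_span top.extremum_unique)
  show thesis
  proof (rule that[OF fB, of "representation B"])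
    show "functional (\<lambda>x. representation B x b)" for b
      by (rule functionalI) (use B sB in \<open>auto simp: representation_add representation_scale\<close>)
    show "(\<Sum>b\<in>B. representation B x b *s b) = x" for x
      by (rule sum_representation_eq) (use B sB fB in auto)
  qed
qed

lemma tensor_bilinear:
  "(x + x') \<otimes> y = x \<otimes> y + x' \<otimes> y" "x \<otimes> (y + y') = x \<otimes> y + x \<otimes> y'"
  "(c *s x) \<otimes> y = scale2 c (x \<otimes> y)" "x \<otimes> (c *s y) = scale2 c (x \<otimes> y)"
  by (auto simp: plus_fun_def tensor_def scale2_def fun_eq_iff functionalD algebra_simps)

lemma tensor3_trilinear:
  "tensor3 (x + x') y z = tensor3 x y z + tensor3 x' y z"
  "tensor3 x (y + y') z = tensor3 x y z + tensor3 x y' z"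
  "tensor3 x y (z + z') = tensor3 x y z + tensor3 x y z'"
  "tensor3 (c *s x) y z = scale3 c (tensor3 x y z)"
  "tensor3 x (c *s y) z = scale3 c (tensor3 x y z)"
  "tensor3 x y (c *s z) = scale3 c (tensor3 x y z)"
  by (auto simp: plus_fun_def tensor3_def scale3_def fun_eq_iff functionalD algebra_simps)

text \<open>Linear maps out of \<open>A \<otimes> A\<close> are functions on the ambient type, hence unique only on
  \<open>tensor_space\<close>.\<close>

theorem tensor_universal:
  fixes scaleW :: "'f \<Rightarrow> 'w::ab_group_add \<Rightarrow> 'w"
  assumes "\<And>x. Vector_Spaces.linear scale scaleW (\<lambda>y. f x y)"
    and "\<And>y. Vector_Spaces.linear scale scaleW (\<lambda>x. f x y)"
  shows "\<exists>g. Vector_Spaces.linear scale2 scaleW g \<and> (\<forall>x y. g (x \<otimes> y) = f x y) \<and>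
    (\<forall>h. Vector_Spaces.linear scale2 scaleW h \<and> (\<forall>x y. h (x \<otimes> y) = f x y) \<longrightarrow>
      (\<forall>t\<in>tensor_space. h t = g t))"
proof -
  interpret W: vector_space scaleW
    using assms(1) by (auto simp: Vector_Spaces.linear_def)
  interpret l: Vector_Spaces.linear scale scaleW "f x" for x using assms(1) .
  interpret r: Vector_Spaces.linear scale scaleW "\<lambda>x. f x y" for y using assms(2) .
  obtain B \<rho> where B: "finite B" "\<And>b. functional (\<lambda>x. \<rho> x b)"
    "\<And>x. (\<Sum>b\<in>B. \<rho> x b *s b) = x" by (rule dual_basis) blast
  define g :: "('a, 'f) tensor2 \<Rightarrow> 'w" where
    "g t = (\<Sum>b\<in>B. \<Sum>c\<in>B. scaleW (t (\<lambda>x. \<rho> x b) (\<lambda>x. \<rho> x c)) (f b c))" for t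
  have lg: "Vector_Spaces.linear scale2 scaleW g"
    by (rule linearI[OF vector_space_scale2 W.vector_space_axioms])
    (auto simp: plus_fun_def g_def scale2_def sum.distrib W.scale_left_distrib W.scale_sum_right
        W.scale_right_distrib scale_right_distrib algebra_simps)
  have g: "g (x \<otimes> y) = f x y" for x y
  proof -
    have 1: "f x y = (\<Sum>b\<in>B. scaleW (\<rho> x b) (f b y))" for x y
      using r.sum[of "\<lambda>b. \<rho> x b *s b" B y] by (simp add: B r.scale)
    have 2: "f x y = (\<Sum>c\<in>B. scaleW (\<rho> y c) (f x c))" for x y
      using l.sum[of x "\<lambda>b. \<rho> y b *s b" B] by (simp add: B l.scale)
    have "f x y = (\<Sum>b\<in>B. scaleW (\<rho> x b) (\<Sum>c\<in>B. scaleW (\<rho> y c) (f b c)))"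
      unfolding 2[symmetric] by (rule 1)
    also have "\<dots> = g (x \<otimes> y)"
      by (simp add: g_def W.scale_sum_right tensor_def B)
    finally show ?thesis ..
  qed
  have "h t = g t" if h: "Vector_Spaces.linear scale2 scaleW h" "\<And>x y. h (x \<otimes> y) = f x y"
    and t: "t \<in> tensor_space" for h t
  proof -
    have lin: "k 0 = 0" "k (s + t) = k s + k t" "k (scale2 c t) = scaleW c (k t)"
      if "Vector_Spaces.linear scale2 scaleW k" for k s t c
      using linear_0'[OF that] that unfolding Vector_Spaces.linear_iff by blast+
    from t show ?thesis
    proof (induction t rule: tensor_space_induct)
      case zero
      show ?case by (simp only: lin[OF h(1)] lin[OF lg])
    next
      case pure
      show ?case by (simp only: h(2) g)
    next
      case (add s t)
      then show ?case by (simp only: lin[OF h(1)] lin[OF lg])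
    next
      case (scale c t)
      then show ?case by (simp only: lin[OF h(1)] lin[OF lg])
    qed
  qed
  with lg g show ?thesis by blast
qed

theorem tensor3_universal:
  fixes scaleW :: "'f \<Rightarrow> 'w::ab_group_add \<Rightarrow> 'w"
  assumes "\<And>x y. Vector_Spaces.linear scale scaleW (\<lambda>z. f x y z)"
    and "\<And>x z. Vector_Spaces.linear scale scaleW (\<lambda>y. f x y z)"
    and "\<And>y z. Vector_Spaces.linear scale scaleW (\<lambda>x. f x y z)"
  shows "\<exists>g. Vector_Spaces.linear scale3 scaleW g \<and> (\<forall>x y z. g (tensor3 x y z) = f x y z) \<and>
    (\<forall>h. Vector_Spaces.linear scale3 scaleW h \<and> (\<forall>x y z. h (tensor3 x y z) = f x y z) \<longrightarrow>
      (\<forall>t\<in>tensor3_space. h t = g t))"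
proof -
  interpret W: vector_space scaleW
    using assms(1) by (auto simp: Vector_Spaces.linear_def)
  interpret l: Vector_Spaces.linear scale scaleW "f x y" for x y using assms(1) .
  interpret m: Vector_Spaces.linear scale scaleW "\<lambda>y. f x y z" for x z using assms(2) .
  interpret r: Vector_Spaces.linear scale scaleW "\<lambda>x. f x y z" for y z using assms(3) .
  obtain B \<rho> where B: "finite B" "\<And>b. functional (\<lambda>x. \<rho> x b)"
    "\<And>x. (\<Sum>b\<in>B. \<rho> x b *s b) = x" by (rule dual_basis) blast
  define g :: "('a, 'f) tensor3 \<Rightarrow> 'w" where
    "g t = (\<Sum>b\<in>B. \<Sum>c\<in>B. \<Sum>d\<in>B.
      scaleW (t (\<lambda>x. \<rho> x b) (\<lambda>x. \<rho> x c) (\<lambda>x. \<rho> x d)) (f b c d))" for t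
  have lg: "Vector_Spaces.linear scale3 scaleW g"
    by (rule linearI[OF vector_space_scale3 W.vector_space_axioms])
    (auto simp: plus_fun_def g_def scale3_def sum.distrib W.scale_left_distrib W.scale_sum_right)
  have g: "g (tensor3 x y z) = f x y z" for x y z
  proof -
    have 1: "f x y z = (\<Sum>b\<in>B. scaleW (\<rho> x b) (f b y z))" for x y z
      using r.sum[of "\<lambda>b. \<rho> x b *s b" B y z] by (simp add: B r.scale)
    have 2: "f x y z = (\<Sum>c\<in>B. scaleW (\<rho> y c) (f x c z))" for x y z
      using m.sum[of x "\<lambda>b. \<rho> y b *s b" B z] by (simp add: B m.scale)
    have 3: "f x y z = (\<Sum>d\<in>B. scaleW (\<rho> z d) (f x y d))" for x y z
      using l.sum[of x y "\<lambda>b. \<rho> z b *s b" B] by (simp add: B l.scale)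
    have "f x y z = (\<Sum>b\<in>B. scaleW (\<rho> x b) (\<Sum>c\<in>B. scaleW (\<rho> y c)
        (\<Sum>d\<in>B. scaleW (\<rho> z d) (f b c d))))"
      unfolding 3[symmetric] 2[symmetric] by (rule 1)
    also have "\<dots> = g (tensor3 x y z)"
      by (simp add: g_def W.scale_sum_right tensor3_def B mult.assoc)
    finally show ?thesis ..
  qed
  have "h t = g t" if h: "Vector_Spaces.linear scale3 scaleW h" "\<And>x y z. h (tensor3 x y z) = f x y z"
    and t: "t \<in> tensor3_space" for h t
  proof -
    have lin: "k 0 = 0" "k (s + t) = k s + k t" "k (scale3 c t) = scaleW c (k t)"
      if "Vector_Spaces.linear scale3 scaleW k" for k s t c
      using linear_0'[OF that] that unfolding Vector_Spaces.linear_iff by blast+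
    from t show ?thesis
    proof (induction t rule: tensor3_space_induct)
      case zero
      show ?case by (simp only: lin[OF h(1)] lin[OF lg])
    next
      case pure
      show ?case by (simp only: h(2) g)
    next
      case (add s t)
      then show ?case by (simp only: lin[OF h(1)] lin[OF lg])
    next
      case (scale c t)
      then show ?case by (simp only: lin[OF h(1)] lin[OF lg])
    qed
  qed
  with lg g show ?thesis by blast
qed

lemma tensor_map_tensor:
  assumes "Vector_Spaces.linear scale scale f" "Vector_Spaces.linear scale scale g"
  shows "(f \<otimes>\<^sub>m g) (x \<otimes> y) = f x \<otimes> g y"
  using assms by (auto simp: tensor_map_def tensor_def functional_comp fun_eq_iff)

lemma tensor_map_linear: "Vector_Spaces.linear scale2 scale2 (f \<otimes>\<^sub>m g)"
  by (rule linearI[OF vector_space_scale2 vector_space_scale2])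
    (auto simp: plus_fun_def tensor_map_def scale2_def fun_eq_iff algebra_simps)

lemma swap_tensor: "\<tau> (x \<otimes> y) = y \<otimes> x"
  by (auto simp: swap_def tensor_def fun_eq_iff)

lemma swap_linear: "Vector_Spaces.linear scale2 scale2 \<tau>"
  by (rule linearI[OF vector_space_scale2 vector_space_scale2])
    (auto simp: plus_fun_def swap_def scale2_def fun_eq_iff algebra_simps)

lemma swap_id_tensor: "\<tau>\<otimes>id (tensor3 x y z) = tensor3 y x z"
  by (auto simp: swap_id_def tensor3_def fun_eq_iff)

lemma swap_id_linear: "Vector_Spaces.linear scale3 scale3 \<tau>\<otimes>id"
  by (rule linearI[OF vector_space_scale3 vector_space_scale3])
    (auto simp: plus_fun_def swap_id_def scale3_def fun_eq_iff algebra_simps)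

lemma comultiplication_functional:
  assumes "comultiplication \<delta>"
  shows "functional (\<lambda>x. \<delta> x \<phi> \<psi>)"
proof -
  interpret d: Vector_Spaces.linear scale scale2 \<delta>
    using assms by (simp add: comultiplication_def)
  show ?thesis by (rule functionalI) (auto simp: d.add d.scale scale2_def)
qed

lemma sum_tensor_apply: "(\<Sum>i\<in>I. (t i :: ('a, 'f) tensor2)) \<phi> \<psi> = (\<Sum>i\<in>I. t i \<phi> \<psi>)"
  by (induction I rule: infinite_finite_induct) auto

lemma sum_tensor3_apply: "(\<Sum>i\<in>I. (t i :: ('a, 'f) tensor3)) \<phi> \<psi> \<chi> = (\<Sum>i\<in>I. t i \<phi> \<psi> \<chi>)"
  by (induction I rule: infinite_finite_induct) auto

lemma id_tensor_tensor:
  assumes "comultiplication \<delta>" "\<delta> y = (\<Sum>i\<in>I. u i \<otimes> v i)"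
  shows "(id\<otimes>\<delta>) (x \<otimes> y) = (\<Sum>i\<in>I. tensor3 x (u i) (v i))"
  by (auto simp: id_tensor_def tensor_def[of x y] comultiplication_functional[OF assms(1)] assms(2)
      fun_eq_iff sum_tensor_apply sum_tensor3_apply tensor3_def sum_distrib_left mult.assoc)
    (auto simp: tensor_def mult.assoc)

lemma id_tensor_linear: "Vector_Spaces.linear scale2 scale3 (id\<otimes>\<delta>)"
  by (rule linearI[OF vector_space_scale2 vector_space_scale3])
    (auto simp: plus_fun_def id_tensor_def scale2_def scale3_def fun_eq_iff algebra_simps)

lemma tensor_id_tensor:
  assumes "comultiplication \<delta>" "\<delta> x = (\<Sum>i\<in>I. u i \<otimes> v i)"
  shows "(\<delta>\<otimes>id) (x \<otimes> y) = (\<Sum>i\<in>I. tensor3 (u i) (v i) y)"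
  by (auto simp: tensor_id_def tensor_def[of x y] comultiplication_functional[OF assms(1)] assms(2)
      fun_eq_iff sum_tensor_apply sum_tensor3_apply tensor3_def sum_distrib_right mult.assoc)
    (auto simp: tensor_def mult.assoc)

lemma tensor_id_linear: "Vector_Spaces.linear scale2 scale3 (\<delta>\<otimes>id)"
  by (rule linearI[OF vector_space_scale2 vector_space_scale3])
    (auto simp: plus_fun_def tensor_id_def scale2_def scale3_def fun_eq_iff algebra_simps)

end


locale dialgebra = fin_dim_space scale
  for scale :: "'f::field_char_0 \<Rightarrow> 'a::ab_group_add \<Rightarrow> 'a" +
  fixes rprod :: "'a \<Rightarrow> 'a \<Rightarrow> 'a" (infixl "\<rhd>" 70)
    and lprod :: "'a \<Rightarrow> 'a \<Rightarrow> 'a" (infixl "\<lhd>" 70)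
  assumes bilinear_rprod: "bilinear_product (\<rhd>)"
    and bilinear_lprod: "bilinear_product (\<lhd>)"
    and assoc_rprod: "(x \<rhd> y) \<rhd> z = x \<rhd> (y \<rhd> z)"
    and assoc_lprod: "(x \<lhd> y) \<lhd> z = x \<lhd> (y \<lhd> z)"
    and dialgebra_1: "(x \<lhd> y) \<lhd> z = x \<lhd> (y \<rhd> z)"
    and dialgebra_2: "(x \<rhd> y) \<lhd> z = x \<rhd> (y \<lhd> z)"
    and dialgebra_3: "(x \<lhd> y) \<rhd> z = x \<rhd> (y \<rhd> z)"

locale co_dialgebra = fin_dim_space scale
  for scale :: "'f::field_char_0 \<Rightarrow> 'a::ab_group_add \<Rightarrow> 'a" +
  fixes rcoprod :: "'a \<Rightarrow> ('a, 'f) tensor2" ("\<delta>\<^sub>\<rhd>")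
    and lcoprod :: "'a \<Rightarrow> ('a, 'f) tensor2" ("\<delta>\<^sub>\<lhd>")
  assumes comultiplication_rcoprod: "comultiplication \<delta>\<^sub>\<rhd>"
    and comultiplication_lcoprod: "comultiplication \<delta>\<^sub>\<lhd>"
    and coassoc_rcoprod: "(id\<otimes>\<delta>\<^sub>\<rhd>) (\<delta>\<^sub>\<rhd> x) = (\<delta>\<^sub>\<rhd>\<otimes>id) (\<delta>\<^sub>\<rhd> x)"
    and coassoc_lcoprod: "(id\<otimes>\<delta>\<^sub>\<lhd>) (\<delta>\<^sub>\<lhd> x) = (\<delta>\<^sub>\<lhd>\<otimes>id) (\<delta>\<^sub>\<lhd> x)"
    and co_dialgebra_1: "(id\<otimes>\<delta>\<^sub>\<lhd>) (\<delta>\<^sub>\<lhd> x) = (id\<otimes>\<delta>\<^sub>\<rhd>) (\<delta>\<^sub>\<lhd> x)"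
    and co_dialgebra_2: "(\<delta>\<^sub>\<rhd>\<otimes>id) (\<delta>\<^sub>\<lhd> x) = (id\<otimes>\<delta>\<^sub>\<lhd>) (\<delta>\<^sub>\<rhd> x)"
    and co_dialgebra_3: "(\<delta>\<^sub>\<lhd>\<otimes>id) (\<delta>\<^sub>\<rhd> x) = (\<delta>\<^sub>\<rhd>\<otimes>id) (\<delta>\<^sub>\<rhd> x)"

locale pre_bi_dialgebra =
  dialgebra scale rprod lprod + co_dialgebra scale rcoprod lcoprod
  for scale :: "'f::field_char_0 \<Rightarrow> 'a::ab_group_add \<Rightarrow> 'a"
    and rprod (infixl "\<rhd>" 70) and lprod (infixl "\<lhd>" 70)
    and rcoprod ("\<delta>\<^sub>\<rhd>") and lcoprod ("\<delta>\<^sub>\<lhd>")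
begin

definition star :: "'a \<Rightarrow> 'a \<Rightarrow> 'a" (infixl "\<star>" 70) where
  "x \<star> y = x \<rhd> y - x \<lhd> y"

definition star_coprod :: "'a \<Rightarrow> ('a, 'f) tensor2" ("\<delta>\<^sub>\<star>") where
  "\<delta>\<^sub>\<star> x = \<delta>\<^sub>\<rhd> x - \<delta>\<^sub>\<lhd> x"

end

locale bi_dialgebra = pre_bi_dialgebra scale rprod lprod rcoprod lcoprod
  for scale :: "'f::field_char_0 \<Rightarrow> 'a::ab_group_add \<Rightarrow> 'a"
    and rprod (infixl "\<rhd>" 70) and lprod (infixl "\<lhd>" 70)
    and rcoprod ("\<delta>\<^sub>\<rhd>") and lcoprod ("\<delta>\<^sub>\<lhd>") +
  assumes bi_dialgebra_1:
      "(id \<otimes>\<^sub>m L (\<lhd>) x) (\<delta>\<^sub>\<lhd> y) = (R (\<rhd>) y \<otimes>\<^sub>m id) (\<delta>\<^sub>\<rhd> x)"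
    and bi_dialgebra_2:
      "(L (\<lhd>) x \<otimes>\<^sub>m id) (\<delta>\<^sub>\<rhd> y) = (id \<otimes>\<^sub>m L (\<lhd>) y) (\<tau> (\<delta>\<^sub>\<rhd> x))"
    and bi_dialgebra_3:
      "(R (\<rhd>) x \<otimes>\<^sub>m id) (\<tau> (\<delta>\<^sub>\<lhd> y)) = (id \<otimes>\<^sub>m R (\<rhd>) y) (\<delta>\<^sub>\<lhd> x)"
    and bi_dialgebra_4:
      "\<delta>\<^sub>\<rhd> (x \<rhd> y) = (id \<otimes>\<^sub>m L (\<rhd>) x) (\<delta>\<^sub>\<rhd> y) - (R (\<star>) y \<otimes>\<^sub>m id) (\<delta>\<^sub>\<star> x)"
    and bi_dialgebra_5:
      "\<delta>\<^sub>\<rhd> (x \<lhd> y) = (id \<otimes>\<^sub>m L (\<lhd>) x) (\<delta>\<^sub>\<star> y) + (R (\<lhd>) y \<otimes>\<^sub>m id) (\<delta>\<^sub>\<rhd> x)"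
    and bi_dialgebra_6:
      "\<delta>\<^sub>\<lhd> (x \<rhd> y) = (id \<otimes>\<^sub>m L (\<star>) x) (\<delta>\<^sub>\<lhd> y) + (R (\<rhd>) y \<otimes>\<^sub>m id) (\<delta>\<^sub>\<lhd> x)"
    and bi_dialgebra_7:
      "\<delta>\<^sub>\<lhd> (x \<lhd> y) = (R (\<lhd>) y \<otimes>\<^sub>m id) (\<delta>\<^sub>\<lhd> x) - (id \<otimes>\<^sub>m L (\<star>) x) (\<delta>\<^sub>\<star> y)"
    and bi_dialgebra_8:
      "(L (\<star>) x \<otimes>\<^sub>m id) (\<delta>\<^sub>\<rhd> y) + (id \<otimes>\<^sub>m L (\<lhd>) y) (\<tau> (\<delta>\<^sub>\<lhd> x)) =
       (R (\<star>) y \<otimes>\<^sub>m id) (\<tau> (\<delta>\<^sub>\<star> x)) + (id \<otimes>\<^sub>m R (\<lhd>) x) (\<delta>\<^sub>\<rhd> y)"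
    and bi_dialgebra_9:
      "(R (\<lhd>) x \<otimes>\<^sub>m id) (\<tau> (\<delta>\<^sub>\<lhd> y)) + (id \<otimes>\<^sub>m R (\<rhd>) y) (\<delta>\<^sub>\<star> x) =
       (L (\<star>) y \<otimes>\<^sub>m id) (\<delta>\<^sub>\<star> x) + (id \<otimes>\<^sub>m L (\<rhd>) x) (\<tau> (\<delta>\<^sub>\<lhd> y))"


locale leibniz_algebra = fin_dim_space scale
  for scale :: "'f::field_char_0 \<Rightarrow> 'a::ab_group_add \<Rightarrow> 'a" +
  fixes bracket :: "'a \<Rightarrow> 'a \<Rightarrow> 'a" ("\<lbrakk>_, _\<rbrakk>")
  assumes bilinear_bracket: "bilinear_product bracket"
    and leibniz: "\<lbrakk>x, \<lbrakk>y, z\<rbrakk>\<rbrakk> = \<lbrakk>\<lbrakk>x, y\<rbrakk>, z\<rbrakk> + \<lbrakk>y, \<lbrakk>x, z\<rbrakk>\<rbrakk>"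

locale leibniz_coalgebra = fin_dim_space scale
  for scale :: "'f::field_char_0 \<Rightarrow> 'a::ab_group_add \<Rightarrow> 'a" +
  fixes cobracket :: "'a \<Rightarrow> ('a, 'f) tensor2" ("\<delta>")
  assumes comultiplication_cobracket: "comultiplication \<delta>"
    and co_leibniz: "(id\<otimes>\<delta>) (\<delta> x) = (\<delta>\<otimes>id) (\<delta> x) + \<tau>\<otimes>id ((id\<otimes>\<delta>) (\<delta> x))"

locale pre_leibniz_bialgebra =
  leibniz_algebra scale bracket + leibniz_coalgebra scale cobracket
  for scale :: "'f::field_char_0 \<Rightarrow> 'a::ab_group_add \<Rightarrow> 'a"
    and bracket ("\<lbrakk>_, _\<rbrakk>") and cobracket ("\<delta>")
begin

definition square :: "'a \<Rightarrow> 'a \<Rightarrow> 'a" (infixl "\<box>" 70) where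
  "x \<box> y = \<lbrakk>x, y\<rbrakk> + \<lbrakk>y, x\<rbrakk>"

definition square_cobracket :: "'a \<Rightarrow> ('a, 'f) tensor2" ("\<delta>\<^sub>\<box>") where
  "\<delta>\<^sub>\<box> x = \<delta> x + \<tau> (\<delta> x)"

end

locale leibniz_bialgebra = pre_leibniz_bialgebra scale bracket cobracket
  for scale :: "'f::field_char_0 \<Rightarrow> 'a::ab_group_add \<Rightarrow> 'a"
    and bracket ("\<lbrakk>_, _\<rbrakk>") and cobracket ("\<delta>") +
  assumes leibniz_bialgebra_1:
      "(id \<otimes>\<^sub>m R bracket x) (\<tau> (\<delta> y)) = (R bracket y \<otimes>\<^sub>m id) (\<delta> x)"
    and leibniz_bialgebra_2:
      "\<delta> \<lbrakk>x, y\<rbrakk> =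
        (id \<otimes>\<^sub>m R bracket y) (\<delta>\<^sub>\<box> x) - (L (\<box>) y \<otimes>\<^sub>m id) (\<delta>\<^sub>\<box> x) +
        (id \<otimes>\<^sub>m L bracket x) (\<delta> y) + (L bracket x \<otimes>\<^sub>m id) (\<delta> y)"

end

theory Submission
  imports Defs
begin

text \<open>
  Evaluating \<open>\<delta>\<^sub>\<rhd> x\<close> and \<open>\<delta>\<^sub>\<lhd> x\<close> at pairs of functionals turns the dual space into a dialgebra, and
  \<open>\<delta>\<^sub>\<rhd> - \<tau>\<delta>\<^sub>\<lhd>\<close> into its bracket; so the co-Leibniz identity is the Leibniz identity of
  the bracket of a dialgebra, applied to the dual. The first compatibility condition is a signed
  sum of bi-dialgebra conditions 1 to 3 at \<open>(y, x)\<close>, with \<open>\<tau>\<close> applied to condition 1, and of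
  condition 1 at \<open>(x, y)\<close>. In the second one, expanding \<open>\<delta> \<lbrakk>x, y\<rbrakk>\<close> by conditions 4 to 7
  leaves \<open>\<tau>\<close> of condition 1 minus conditions 2, 8 and 9, all at \<open>(x, y)\<close>.
\<close>

lemma swap_swap [simp]: "\<tau> (\<tau> t) = t"
  by (simp add: swap_def)

lemma swap_add: "\<tau> (s + t) = \<tau> s + \<tau> t"
  and swap_diff: "\<tau> (s - t) = \<tau> s - \<tau> t"
  by (simp_all add: swap_def fun_eq_iff)

context fin_dim_space
begin

lemma functional_diff:
  "functional \<phi> \<Longrightarrow> functional \<psi> \<Longrightarrow> functional (\<lambda>x. \<phi> x - \<psi> x)"
  by (rule functionalI) (auto simp: functionalD algebra_simps)

lemma linear_scale_diff:
  assumes "Vector_Spaces.linear scale scale f" "Vector_Spaces.linear scale scale g"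
  shows "Vector_Spaces.linear scale scale (\<lambda>x. f x - g x)"
  using assms by (auto simp: Vector_Spaces.linear_iff algebra_simps)

lemma bilinear_product_left: "bilinear_product p \<Longrightarrow> Vector_Spaces.linear scale scale (L p x)"
  and bilinear_product_right: "bilinear_product p \<Longrightarrow> Vector_Spaces.linear scale scale (R p x)"
  by (simp_all add: bilinear_product_def left_mult_def right_mult_def)

lemma bilinear_productD:
  assumes "bilinear_product p"
  shows "p (x + y) z = p x z + p y z" "p z (x + y) = p z x + p z y"
    "p (x - y) z = p x z - p y z" "p z (x - y) = p z x - p z y"
    "p (c *s x) z = c *s p x z" "p z (c *s x) = c *s p z x"
proof -
  interpret l: Vector_Spaces.linear scale scale "p u" for u
    using assms by (simp add: bilinear_product_def)
  interpret r: Vector_Spaces.linear scale scale "\<lambda>u. p u v" for v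
    using assms by (simp add: bilinear_product_def)
  show "p (x + y) z = p x z + p y z" "p z (x + y) = p z x + p z y"
    "p (x - y) z = p x z - p y z" "p z (x - y) = p z x - p z y"
    "p (c *s x) z = c *s p x z" "p z (c *s x) = c *s p z x"
    by (fact r.add l.add r.diff l.diff r.scale l.scale)+
qed

text \<open>A function of type \<open>tensor2\<close> need not be additive in its arguments;
  elements of \<open>tensor_space\<close> are, on functionals. \<open>\<phi>\<close> and
  \<open>\<phi>'\<close> are each required to be functionals because the difference of two other
  functions may be one. Where \<open>\<psi>\<close> is not a functional, both sides vanish.\<close>

lemma tensor_space_diff_left:
  assumes "t \<in> tensor_space" "functional \<phi>" "functional \<phi>'"
  shows "t (\<lambda>x. \<phi> x - \<phi>' x) \<psi> = t \<phi> \<psi> - t \<phi>' \<psi>"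
  using assms(1)
  by (induction t rule: tensor_space_induct)
    (use assms in \<open>auto simp: tensor_def scale2_def functional_diff left_diff_distrib right_diff_distrib
      add_diff_add\<close>)

text \<open>Since \<tau> is linear and permutes pure tensors. Statements about the right factor then
  follow from those about the left by conjugating with \<tau>.\<close>

lemma tensor_space_swap: "t \<in> tensor_space \<Longrightarrow> \<tau> t \<in> tensor_space"
proof (induction t rule: tensor_space_induct)
  interpret T: vector_space scale2 by (rule vector_space_scale2)
  interpret swap: Vector_Spaces.linear scale2 scale2 \<tau> by (rule swap_linear)
  case zero
  show ?case by (simp only: swap.zero tensor_space_def T.span_zero)
  case (pure x y)
  show ?case unfolding swap_tensor tensor_space_def by (rule T.span_base) blast
  case (add s t)
  then show ?case by (simp only: swap.add tensor_space_def T.span_add)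
  case (scale c t)
  then show ?case by (simp only: swap.scale tensor_space_def T.span_scale)
qed

lemma tensor_space_diff: "s \<in> tensor_space \<Longrightarrow> t \<in> tensor_space \<Longrightarrow> s - t \<in> tensor_space"
proof -
  interpret T: vector_space scale2 by (rule vector_space_scale2)
  show "s \<in> tensor_space \<Longrightarrow> t \<in> tensor_space \<Longrightarrow> s - t \<in> tensor_space"
    unfolding tensor_space_def by (rule T.span_diff)
qed

lemma tensor_space_diff_right:
  assumes "t \<in> tensor_space" "functional \<psi>" "functional \<psi>'"
  shows "t \<phi> (\<lambda>x. \<psi> x - \<psi>' x) = t \<phi> \<psi> - t \<phi> \<psi>'"
  using tensor_space_diff_left[OF tensor_space_swap assms(2,3), of t \<phi>] assms(1)
  by (simp add: swap_def)

text \<open>Pushes \<tau> inwards until it stands directly on a coproduct, which gives all terms of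
  the final computation a common normal form.\<close>

lemma swap_tensor_map: "\<tau> ((f \<otimes>\<^sub>m g) t) = (g \<otimes>\<^sub>m f) (\<tau> t)"
  by (auto simp: swap_def tensor_map_def fun_eq_iff)

lemma tensor_map_add: "(f \<otimes>\<^sub>m g) (s + t) = (f \<otimes>\<^sub>m g) s + (f \<otimes>\<^sub>m g) t"
  and tensor_map_diff: "(f \<otimes>\<^sub>m g) (s - t) = (f \<otimes>\<^sub>m g) s - (f \<otimes>\<^sub>m g) t"
  by (auto simp: tensor_map_def fun_eq_iff)

text \<open>The difference now sits in the functional at which \<open>t\<close> is evaluated, and
  not in \<open>t\<close> as in \<open>tensor_map_diff\<close>; this is where bilinearity of
  \<open>t\<close> enters.\<close>

lemma tensor_map_diff_left:
  assumes "t \<in> tensor_space" "Vector_Spaces.linear scale scale f" "Vector_Spaces.linear scale scale g"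
  shows "((\<lambda>x. f x - g x) \<otimes>\<^sub>m h) t = (f \<otimes>\<^sub>m h) t - (g \<otimes>\<^sub>m h) t"
proof -
  have "t (\<phi> \<circ> (\<lambda>x. f x - g x)) \<psi> = t (\<phi> \<circ> f) \<psi> - t (\<phi> \<circ> g) \<psi>" if "functional \<phi>" for \<phi> \<psi>
  proof -
    interpret \<phi>: Vector_Spaces.linear scale "(*)" \<phi> using that by (simp add: functional_def)
    have "\<phi> \<circ> (\<lambda>x. f x - g x) = (\<lambda>x. (\<phi> \<circ> f) x - (\<phi> \<circ> g) x)" by (simp add: fun_eq_iff \<phi>.diff)
    then show ?thesis
      using tensor_space_diff_left[OF assms(1) functional_comp functional_comp] that assms by simp
  qed
  then show ?thesis by (auto simp: tensor_map_def fun_eq_iff)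
qed

lemma tensor_map_diff_right:
  assumes "t \<in> tensor_space" "Vector_Spaces.linear scale scale f" "Vector_Spaces.linear scale scale g"
  shows "(h \<otimes>\<^sub>m (\<lambda>x. f x - g x)) t = (h \<otimes>\<^sub>m f) t - (h \<otimes>\<^sub>m g) t"
  using arg_cong[OF tensor_map_diff_left[OF tensor_space_swap assms(2,3)], of t \<tau> h] assms(1)
  by (simp add: swap_tensor_map swap_diff)

end

context dialgebra
begin

text \<open>After expansion the four terms on the left match four on the right. The other four
  cancel in pairs, by \<open>(y \<lhd> x) \<rhd> z = y \<rhd> (x \<rhd> z)\<close> and
  \<open>z \<lhd> (x \<rhd> y) = (z \<lhd> x) \<lhd> y\<close>.\<close>

lemma leibniz_algebra_commutator: "leibniz_algebra scale (\<lambda>x y. x \<rhd> y - y \<lhd> x)"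
proof
  show "bilinear_product (\<lambda>x y. x \<rhd> y - y \<lhd> x)"
    unfolding bilinear_product_def
    by (intro conjI allI linearI vector_space_axioms)
      (simp_all add: bilinear_productD[OF bilinear_rprod] bilinear_productD[OF bilinear_lprod]
        algebra_simps)
  show "x \<rhd> (y \<rhd> z - z \<lhd> y) - (y \<rhd> z - z \<lhd> y) \<lhd> x =
      (x \<rhd> y - y \<lhd> x) \<rhd> z - z \<lhd> (x \<rhd> y - y \<lhd> x) + (y \<rhd> (x \<rhd> z - z \<lhd> x) - (x \<rhd> z - z \<lhd> x) \<lhd> y)"
    for x y z
    \<comment> \<open>\<open>dialgebra_1\<close> and \<open>assoc_lprod\<close> have the same
      left-hand side. Only the latter serves as a rewrite rule; the instance of the former then
      becomes \<open>z \<lhd> (x \<lhd> y) = z \<lhd> (x \<rhd> y)\<close>.\<close>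
    using dialgebra_1[of z x y] assoc_lprod[of z x y]
    by (simp add: bilinear_productD[OF bilinear_rprod] bilinear_productD[OF bilinear_lprod]
        assoc_rprod assoc_lprod dialgebra_2 dialgebra_3 algebra_simps)
qed

end

context co_dialgebra
begin

lemma rcoprod_in_tensor_space: "\<delta>\<^sub>\<rhd> x \<in> tensor_space"
  and lcoprod_in_tensor_space: "\<delta>\<^sub>\<lhd> x \<in> tensor_space"
  using comultiplication_rcoprod comultiplication_lcoprod by (simp_all add: comultiplication_def)

lemma rcoprod_diff: "\<delta>\<^sub>\<rhd> (x - y) = \<delta>\<^sub>\<rhd> x - \<delta>\<^sub>\<rhd> y"
  and lcoprod_diff: "\<delta>\<^sub>\<lhd> (x - y) = \<delta>\<^sub>\<lhd> x - \<delta>\<^sub>\<lhd> y"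
proof -
  interpret r: Vector_Spaces.linear scale scale2 "\<delta>\<^sub>\<rhd>"
    using comultiplication_rcoprod by (simp add: comultiplication_def)
  interpret l: Vector_Spaces.linear scale scale2 "\<delta>\<^sub>\<lhd>"
    using comultiplication_lcoprod by (simp add: comultiplication_def)
  show "\<delta>\<^sub>\<rhd> (x - y) = \<delta>\<^sub>\<rhd> x - \<delta>\<^sub>\<rhd> y" "\<delta>\<^sub>\<lhd> (x - y) = \<delta>\<^sub>\<lhd> x - \<delta>\<^sub>\<lhd> y"
    by (fact r.diff l.diff)+
qed

text \<open>Since \<tau> reverses the arguments of \<open>\<delta>\<^sub>\<lhd>\<close>, the dual
  bracket is again \<open>\<alpha> \<rhd> \<beta> - \<beta> \<lhd> \<alpha>\<close>. At
  \<open>\<phi> \<psi> \<chi>\<close> the three terms of the co-Leibniz identity are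
  \<open>[\<phi>, [\<psi>, \<chi>]]\<close>, \<open>[[\<phi>, \<psi>], \<chi>]\<close> and
  \<open>[\<psi>, [\<phi>, \<chi>]]\<close>, evaluated at \<open>x\<close>.\<close>

lemma leibniz_coalgebra_cocommutator: "leibniz_coalgebra scale (\<lambda>x. \<delta>\<^sub>\<rhd> x - \<tau> (\<delta>\<^sub>\<lhd> x))"
proof
  interpret r: Vector_Spaces.linear scale scale2 "\<delta>\<^sub>\<rhd>"
    using comultiplication_rcoprod by (simp add: comultiplication_def)
  interpret l: Vector_Spaces.linear scale scale2 "\<delta>\<^sub>\<lhd>"
    using comultiplication_lcoprod by (simp add: comultiplication_def)
  let ?\<delta> = "\<lambda>x. \<delta>\<^sub>\<rhd> x - \<tau> (\<delta>\<^sub>\<lhd> x)"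
  show "comultiplication ?\<delta>"
    unfolding comultiplication_def
  proof (intro conjI allI)
    show "Vector_Spaces.linear scale scale2 ?\<delta>"
      by (rule linearI[OF vector_space_axioms vector_space_scale2])
        (auto simp: r.add l.add r.scale l.scale swap_def scale2_def fun_eq_iff algebra_simps)
    show "?\<delta> x \<in> tensor_space" for x
      by (intro tensor_space_diff tensor_space_swap rcoprod_in_tensor_space lcoprod_in_tensor_space)
  qed
  show "(id\<otimes>?\<delta>) (?\<delta> x) = (?\<delta>\<otimes>id) (?\<delta> x) + \<tau>\<otimes>id ((id\<otimes>?\<delta>) (?\<delta> x))" for x
  proof (intro ext)
    fix \<phi> \<psi> \<chi>
    show "(id\<otimes>?\<delta>) (?\<delta> x) \<phi> \<psi> \<chi> = ((?\<delta>\<otimes>id) (?\<delta> x) + \<tau>\<otimes>id ((id\<otimes>?\<delta>) (?\<delta> x))) \<phi> \<psi> \<chi>"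
    proof (cases "functional \<phi> \<and> functional \<psi> \<and> functional \<chi>")
      case True
      \<comment> \<open>The dual products of functionals are functionals, so
        \<open>\<delta>\<^sub>\<rhd> x\<close> and \<open>\<delta>\<^sub>\<lhd> x\<close> are
        additive on their differences.\<close>
      note fct = comultiplication_functional[OF comultiplication_rcoprod]
        comultiplication_functional[OF comultiplication_lcoprod]
      note diff = tensor_space_diff_left[OF rcoprod_in_tensor_space fct]
        tensor_space_diff_left[OF lcoprod_in_tensor_space fct(2,1)]
        tensor_space_diff_right[OF rcoprod_in_tensor_space fct]
        tensor_space_diff_left[OF lcoprod_in_tensor_space fct]
        tensor_space_diff_right[OF lcoprod_in_tensor_space fct]
      \<comment> \<open>The axioms of a dialgebra for the dual products
        \<open>\<lambda>y. \<delta>\<^sub>\<rhd> y \<alpha> \<beta>\<close> and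
        \<open>\<lambda>y. \<delta>\<^sub>\<lhd> y \<alpha> \<beta>\<close>, up to
        associativity.\<close>
      have dual:
        "\<delta>\<^sub>\<rhd> x \<alpha> (\<lambda>y. \<delta>\<^sub>\<rhd> y \<beta> \<gamma>) = \<delta>\<^sub>\<rhd> x (\<lambda>y. \<delta>\<^sub>\<rhd> y \<alpha> \<beta>) \<gamma>"
        "\<delta>\<^sub>\<lhd> x \<alpha> (\<lambda>y. \<delta>\<^sub>\<lhd> y \<beta> \<gamma>) = \<delta>\<^sub>\<lhd> x (\<lambda>y. \<delta>\<^sub>\<lhd> y \<alpha> \<beta>) \<gamma>"
        "\<delta>\<^sub>\<lhd> x \<alpha> (\<lambda>y. \<delta>\<^sub>\<rhd> y \<beta> \<gamma>) = \<delta>\<^sub>\<lhd> x (\<lambda>y. \<delta>\<^sub>\<lhd> y \<alpha> \<beta>) \<gamma>"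
        "\<delta>\<^sub>\<rhd> x \<alpha> (\<lambda>y. \<delta>\<^sub>\<lhd> y \<beta> \<gamma>) = \<delta>\<^sub>\<lhd> x (\<lambda>y. \<delta>\<^sub>\<rhd> y \<alpha> \<beta>) \<gamma>"
        "\<delta>\<^sub>\<rhd> x (\<lambda>y. \<delta>\<^sub>\<lhd> y \<alpha> \<beta>) \<gamma> = \<delta>\<^sub>\<rhd> x (\<lambda>y. \<delta>\<^sub>\<rhd> y \<alpha> \<beta>) \<gamma>"
        if "functional \<alpha>" "functional \<beta>" "functional \<gamma>" for \<alpha> \<beta> \<gamma>
        using coassoc_rcoprod[of x, THEN fun_cong, THEN fun_cong, THEN fun_cong, of \<alpha> \<beta> \<gamma>]
          coassoc_lcoprod[of x, THEN fun_cong, THEN fun_cong, THEN fun_cong, of \<alpha> \<beta> \<gamma>]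
          co_dialgebra_1[of x, THEN fun_cong, THEN fun_cong, THEN fun_cong, of \<alpha> \<beta> \<gamma>]
          co_dialgebra_2[of x, THEN fun_cong, THEN fun_cong, THEN fun_cong, of \<alpha> \<beta> \<gamma>]
          co_dialgebra_3[of x, THEN fun_cong, THEN fun_cong, THEN fun_cong, of \<alpha> \<beta> \<gamma>] that
        by (simp_all add: id_tensor_def tensor_id_def)
      show ?thesis
        using True by (simp add: id_tensor_def tensor_id_def swap_id_def swap_def diff dual)
    next
      case False
      then show ?thesis by (auto simp: id_tensor_def tensor_id_def swap_id_def)
    qed
  qed
qed

end

theorem theorem3p12:
  fixes scale :: "'f::field_char_0 \<Rightarrow> 'a::ab_group_add \<Rightarrow> 'a"
    and rprod lprod :: "'a \<Rightarrow> 'a \<Rightarrow> 'a"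
    and rcoprod lcoprod :: "'a \<Rightarrow> ('a, 'f) tensor2"
  assumes "bi_dialgebra scale rprod lprod rcoprod lcoprod"
  shows "leibniz_bialgebra scale
    (\<lambda>x y. rprod x y - lprod y x)
    (\<lambda>x. rcoprod x - \<tau> (lcoprod x))"
proof -
  interpret bi_dialgebra scale rprod lprod rcoprod lcoprod by fact
  let ?b = "\<lambda>x y. rprod x y - lprod y x" and ?\<delta> = "\<lambda>x. rcoprod x - \<tau> (lcoprod x)"
  interpret B: leibniz_algebra scale ?b by (rule leibniz_algebra_commutator)
  interpret C: leibniz_coalgebra scale ?\<delta> by (rule leibniz_coalgebra_cocommutator)
  interpret P: pre_leibniz_bialgebra scale ?b ?\<delta> ..
  note [simp] = rcoprod_in_tensor_space lcoprod_in_tensor_space tensor_space_swap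
    bilinear_product_left bilinear_product_right bilinear_rprod bilinear_lprod
  have R_bracket: "R ?b y = (\<lambda>x. R rprod y x - L lprod y x)"
    and L_bracket: "L ?b y = (\<lambda>x. L rprod y x - R lprod y x)"
    and R_star: "R star y = (\<lambda>x. R rprod y x - R lprod y x)"
    and L_star: "L star y = (\<lambda>x. L rprod y x - L lprod y x)" for y
    by (simp_all add: left_mult_def right_mult_def star_def)
  \<comment> \<open>The square product is the symmetrization of \<open>star\<close>: this is left
    plus right \<open>star\<close> multiplication by \<open>y\<close>, written with differences only
    so that \<open>tensor_map_diff_left\<close> applies. Likewise \<open>P.square_cobracket\<close>
    is \<open>star_coprod\<close> plus its flip.\<close>
  have L_square: "L P.square y = (\<lambda>x. (L rprod y x - L lprod y x) - (R lprod y x - R rprod y x))" for y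
    by (simp add: left_mult_def right_mult_def P.square_def fun_eq_iff)
  have square_cobracket: "P.square_cobracket x = rcoprod x - lcoprod x + \<tau> (rcoprod x - lcoprod x)" for x
    by (simp add: P.square_cobracket_def swap_diff)
  note expand = R_bracket L_bracket R_star L_star L_square square_cobracket star_coprod_def
    swap_add swap_diff swap_tensor_map tensor_map_add tensor_map_diff
    tensor_map_diff_left tensor_map_diff_right linear_scale_diff
  show ?thesis
  proof
    fix x y
    show "(id \<otimes>\<^sub>m R ?b x) (\<tau> (?\<delta> y)) = (R ?b y \<otimes>\<^sub>m id) (?\<delta> x)"
      \<comment> \<open>Both sides expand to four terms, and each of these four facts equates one
        term on the left with one on the right.\<close>
      using bi_dialgebra_1[of x y] arg_cong[OF bi_dialgebra_1[of y x], of \<tau>]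
        bi_dialgebra_2[of y x] bi_dialgebra_3[of y x]
      by (simp add: expand)
    \<comment> \<open>Once conditions 4 to 7 are substituted, this is an identity of signed sums of
      terms. Each group on the right is the difference of the two sides of one condition, left
      unexpanded so that the condition itself rewrites it to 0.\<close>
    have "?\<delta> (?b x y) - ((id \<otimes>\<^sub>m R ?b y) (P.square_cobracket x) -
        (L P.square y \<otimes>\<^sub>m id) (P.square_cobracket x) +
        (id \<otimes>\<^sub>m L ?b x) (?\<delta> y) + (L ?b x \<otimes>\<^sub>m id) (?\<delta> y)) =
      (\<tau> ((id \<otimes>\<^sub>m L lprod x) (lcoprod y)) - \<tau> ((R rprod y \<otimes>\<^sub>m id) (rcoprod x))) -
      ((L lprod x \<otimes>\<^sub>m id) (rcoprod y) - (id \<otimes>\<^sub>m L lprod y) (\<tau> (rcoprod x))) -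
      ((L star x \<otimes>\<^sub>m id) (rcoprod y) + (id \<otimes>\<^sub>m L lprod y) (\<tau> (lcoprod x)) -
       ((R star y \<otimes>\<^sub>m id) (\<tau> (star_coprod x)) + (id \<otimes>\<^sub>m R lprod x) (rcoprod y))) -
      ((R lprod x \<otimes>\<^sub>m id) (\<tau> (lcoprod y)) + (id \<otimes>\<^sub>m R rprod y) (star_coprod x) -
       ((L star y \<otimes>\<^sub>m id) (star_coprod x) + (id \<otimes>\<^sub>m L rprod x) (\<tau> (lcoprod y))))"
      by (simp add: rcoprod_diff lcoprod_diff bi_dialgebra_4 bi_dialgebra_5 bi_dialgebra_6
          bi_dialgebra_7 expand)
    also have "\<dots> = 0"
      by (simp only: bi_dialgebra_1 bi_dialgebra_2 bi_dialgebra_8 bi_dialgebra_9 diff_self)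
    finally show "?\<delta> (?b x y) = (id \<otimes>\<^sub>m R ?b y) (P.square_cobracket x) -
        (L P.square y \<otimes>\<^sub>m id) (P.square_cobracket x) +
        (id \<otimes>\<^sub>m L ?b x) (?\<delta> y) + (L ?b x \<otimes>\<^sub>m id) (?\<delta> y)"
      by (simp only: right_minus_eq)
  qed
qed

end
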